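(* For every integer $n\ge 0$ the following identities hold in the ring $\mathbb{D}$ of dual numbers: (i) $jD_{n+3}^{(3)}-3JD_{n+3}^{(3)}=2jD_{n}^{(3)}$; (ii) $jD_{n}^{(3)}+jD_{n+1}^{(3)}=3JD_{n+2}^{(3)}$; (iii) $jD_{n}^{(3)}-JD_{n+2}^{(3)}=\begin{cases}1-\varepsilon & \text{if } n\equiv 0 \pmod 3,\\ -1 & \text{if } n\equiv 1 \pmod 3,\\ \varepsilon & \text{if } n\equiv 2 \pmod 3;\end{cases}$ (iv) $jD_{n}^{(3)}-4JD_{n}^{(3)}=\begin{cases}2-3\varepsilon & \text{if } n\equiv 0 \pmod 3,\\ -3+\varepsilon & \text{if } n\equiv 1 \pmod 3,\\ 1+2\varepsilon & \text{if } n\equiv 2 \pmod 3.\end{cases}$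
   Context: $\mathbb{D}=\mathbb{R}[\varepsilon]=\{a+\varepsilon b: a,b\in\mathbb{R}\}$ with $\varepsilon\ne0$, $\varepsilon^2=0$, is the commutative ring of dual numbers. The third order Jacobsthal numbers are defined by $J_0^{(3)}=0$, $J_1^{(3)}=J_2^{(3)}=1$, $J_{n+3}^{(3)}=J_{n+2}^{(3)}+J_{n+1}^{(3)}+2J_n^{(3)}$ for $n\ge0$. The third order Jacobsthal-Lucas numbers are defined by $j_0^{(3)}=2$, $j_1^{(3)}=1$, $j_2^{(3)}=5$, $j_{n+3}^{(3)}=j_{n+2}^{(3)}+j_{n+1}^{(3)}+2j_n^{(3)}$ for $n\ge0$. For $n\ge0$, the dual third order Jacobsthal and dual third order Jacobsthal-Lucas numbers are $JD_n^{(3)}=J_n^{(3)}+\varepsilon J_{n+1}^{(3)}$ and $jD_n^{(3)}=j_n^{(3)}+\varepsilon j_{n+1}^{(3)}$. *)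

theory Defs
  imports Complex_Main
begin

text \<open>The ring of dual numbers over the reals: \<open>Dual a b\<close> stands for \<open>a + \<epsilon> b\<close>
  (see \<open>Dual_eq\<close> below).\<close>

datatype dual = Dual (std_part: real) (eps_part: real)

instantiation dual :: real_algebra_1
begin

definition zero_dual :: dual where "0 = Dual 0 0"

definition one_dual :: dual where "1 = Dual 1 0"

definition plus_dual :: "dual \<Rightarrow> dual \<Rightarrow> dual" where
  "x + y = Dual (std_part x + std_part y) (eps_part x + eps_part y)"

definition uminus_dual :: "dual \<Rightarrow> dual" where
  "- x = Dual (- std_part x) (- eps_part x)"

definition minus_dual :: "dual \<Rightarrow> dual \<Rightarrow> dual" where
  "x - y = Dual (std_part x - std_part y) (eps_part x - eps_part y)"

definition times_dual :: "dual \<Rightarrow> dual \<Rightarrow> dual" where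
  "x * y = Dual (std_part x * std_part y) (std_part x * eps_part y + eps_part x * std_part y)"

definition scaleR_dual :: "real \<Rightarrow> dual \<Rightarrow> dual" where
  "r *\<^sub>R x = Dual (r * std_part x) (r * eps_part x)"

instance
  by standard
    (simp_all add: zero_dual_def one_dual_def plus_dual_def uminus_dual_def minus_dual_def
      times_dual_def scaleR_dual_def dual.expand algebra_simps)

end

instance dual :: comm_ring_1
  by standard (simp_all add: times_dual_def one_dual_def plus_dual_def algebra_simps)

definition eps :: dual  (\<open>\<epsilon>\<close>) where "\<epsilon> = Dual 0 1"

lemma eps_neq_0: "\<epsilon> \<noteq> 0"
  by (simp add: eps_def zero_dual_def)

lemma eps_squared: "\<epsilon>\<^sup>2 = 0"
  by (simp add: eps_def zero_dual_def times_dual_def power2_eq_square)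

lemma Dual_eq: "Dual a b = of_real a + \<epsilon> * of_real b"
  by (simp add: eps_def of_real_def one_dual_def plus_dual_def times_dual_def scaleR_dual_def)

fun jacobsthal3 :: "nat \<Rightarrow> int" where
  "jacobsthal3 0 = 0"
| "jacobsthal3 (Suc 0) = 1"
| "jacobsthal3 (Suc (Suc 0)) = 1"
| "jacobsthal3 (Suc (Suc (Suc n))) =
     jacobsthal3 (Suc (Suc n)) + jacobsthal3 (Suc n) + 2 * jacobsthal3 n"

fun jacobsthal_lucas3 :: "nat \<Rightarrow> int" where
  "jacobsthal_lucas3 0 = 2"
| "jacobsthal_lucas3 (Suc 0) = 1"
| "jacobsthal_lucas3 (Suc (Suc 0)) = 5"
| "jacobsthal_lucas3 (Suc (Suc (Suc n))) =
     jacobsthal_lucas3 (Suc (Suc n)) + jacobsthal_lucas3 (Suc n) + 2 * jacobsthal_lucas3 n"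

definition JD3 :: "nat \<Rightarrow> dual" where
  "JD3 n = of_int (jacobsthal3 n) + \<epsilon> * of_int (jacobsthal3 (n + 1))"

definition jD3 :: "nat \<Rightarrow> dual" where
  "jD3 n = of_int (jacobsthal_lucas3 n) + \<epsilon> * of_int (jacobsthal_lucas3 (n + 1))"

end

theory Submission
  imports Defs
begin

text \<open>
  Multiplication by \<open>\<epsilon>\<close> and the index shift are linear, so both dual sequences satisfy, in the ring
  of dual numbers, the same recurrence \<open>s (n + 3) = s (n + 2) + s (n + 1) + 2 * s n\<close> as their integer
  components, and so does every linear combination of their shifts. All four identities are
  about such combinations.

  For (i) and (ii), the difference of the two sides solves the recurrence and vanishes at
  \<open>0, 1, 2\<close>, hence everywhere (\<open>third_order_rec_zero\<close>).

  For (iii) and (iv), the characteristic polynomial factors as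
  \<open>x\<^sup>3 - x\<^sup>2 - x - 2 = (x - 2) * (x\<^sup>2 + x + 1)\<close>. The combinations on the left are those in which the
  powers of \<open>2\<close> cancel, which shows in their first three values summing to \<open>0\<close>. Only powers of the
  primitive cube roots of unity remain, so the sequence repeats these three values
  (\<open>third_order_rec_periodic\<close>).
\<close>

definition third_order_rec :: "(nat \<Rightarrow> 'a::comm_ring_1) \<Rightarrow> bool" where
  "third_order_rec s \<longleftrightarrow> (\<forall>n. s (n + 3) = s (n + 2) + s (n + 1) + 2 * s n)"

lemma third_order_rec_shift:
  "third_order_rec s \<Longrightarrow> third_order_rec (\<lambda>n. s (n + k))"
  unfolding third_order_rec_def by (metis add.commute add.left_commute)

lemma third_order_rec_diff:
  "third_order_rec s \<Longrightarrow> third_order_rec t \<Longrightarrow> third_order_rec (\<lambda>n. s n - t n)"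
  by (simp add: third_order_rec_def algebra_simps)

lemma third_order_rec_add:
  "third_order_rec s \<Longrightarrow> third_order_rec t \<Longrightarrow> third_order_rec (\<lambda>n. s n + t n)"
  by (simp add: third_order_rec_def algebra_simps)

lemma third_order_rec_mult:
  "third_order_rec s \<Longrightarrow> third_order_rec (\<lambda>n. c * s n)"
  by (simp add: third_order_rec_def algebra_simps)

lemma third_order_rec_zero:
  assumes "third_order_rec s" "s 0 = 0" "s 1 = 0" "s 2 = 0"
  shows "s n = 0"
proof -
  have "s n = 0 \<and> s (n + 1) = 0 \<and> s (n + 2) = 0"
  proof (induction n)
    case 0
    then show ?case using assms by (simp add: numeral_2_eq_2)
  next
    case (Suc n)
    have "s (n + 3) = s (n + 2) + s (n + 1) + 2 * s n"
      using assms(1) by (simp add: third_order_rec_def)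
    with Suc show ?case by (simp add: numeral_3_eq_3 numeral_2_eq_2)
  qed
  then show ?thesis by simp
qed

text \<open>
  Applying the factor \<open>x\<^sup>2 + x + 1\<close> of the characteristic polynomial to \<open>s\<close> leaves the sums of three
  consecutive terms, which the remaining factor \<open>x - 2\<close> makes double at each step. If the first sum
  is \<open>0\<close>, all are, and subtracting two neighbouring sums gives \<open>s (n + 3) = s n\<close>.
\<close>

lemma third_order_rec_periodic:
  assumes rec: "third_order_rec s" and init: "s 0 + s 1 + s 2 = 0"
  shows "s n = (if n mod 3 = 0 then s 0 else if n mod 3 = 1 then s 1 else s 2)"
proof -
  have sum: "s k + s (k + 1) + s (k + 2) = 0" for k
  proof (induction k)
    case 0
    then show ?case using init by (simp add: numeral_2_eq_2)
  next
    case (Suc k)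
    have "s (k + 1) + s (k + 2) + s (k + 3) = 2 * (s k + s (k + 1) + s (k + 2))"
      using rec by (simp add: third_order_rec_def algebra_simps)
    with Suc show ?case by (simp add: numeral_3_eq_3 numeral_2_eq_2)
  qed
  have period: "s (k + 3) = s k" for k
  proof -
    have "s (k + 3) - s k = (s (k + 1) + s (k + 2) + s (k + 3)) - (s k + s (k + 1) + s (k + 2))"
      by (simp add: algebra_simps)
    also have "\<dots> = 0"
      using sum[of k] sum[of "k + 1"] by (simp add: numeral_3_eq_3 numeral_2_eq_2)
    finally show ?thesis by simp
  qed
  have "s (r + 3 * q) = s r" for r q
  proof (induction q)
    case (Suc q)
    then show ?case using period[of "r + 3 * q"] by (simp add: algebra_simps)
  qed simp
  from this[of "n mod 3" "n div 3"] have "s n = s (n mod 3)"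
    by simp
  moreover have "n mod 3 = 0 \<or> n mod 3 = 1 \<or> n mod 3 = 2" by linarith
  ultimately show ?thesis by auto
qed

lemma third_order_rec_JD3: "third_order_rec JD3"
  by (simp add: third_order_rec_def JD3_def numeral_3_eq_3 numeral_2_eq_2 algebra_simps)

lemma third_order_rec_jD3: "third_order_rec jD3"
  by (simp add: third_order_rec_def jD3_def numeral_3_eq_3 numeral_2_eq_2 algebra_simps)

lemma JD3_values:
  "JD3 0 = \<epsilon>" "JD3 (Suc 0) = 1 + \<epsilon>" "JD3 2 = 1 + 2 * \<epsilon>" "JD3 3 = 2 + 5 * \<epsilon>" "JD3 4 = 5 + 9 * \<epsilon>"
  "JD3 5 = 9 + 18 * \<epsilon>"
  by (simp_all add: JD3_def eval_nat_numeral)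

lemma jD3_values:
  "jD3 0 = 2 + \<epsilon>" "jD3 (Suc 0) = 1 + 5 * \<epsilon>" "jD3 2 = 5 + 10 * \<epsilon>" "jD3 3 = 10 + 17 * \<epsilon>"
  "jD3 4 = 17 + 37 * \<epsilon>" "jD3 5 = 37 + 74 * \<epsilon>"
  by (simp_all add: jD3_def eval_nat_numeral)

lemmas third_order_rec_intros =
  third_order_rec_diff third_order_rec_add third_order_rec_mult third_order_rec_shift
  third_order_rec_JD3 third_order_rec_jD3

theorem theorem2p2:
  fixes n :: nat
  shows "jD3 (n + 3) - 3 * JD3 (n + 3) = 2 * jD3 n
    \<and> jD3 n + jD3 (n + 1) = 3 * JD3 (n + 2)
    \<and> jD3 n - JD3 (n + 2) =
         (if n mod 3 = 0 then 1 - \<epsilon> else if n mod 3 = 1 then - 1 else \<epsilon>)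
    \<and> jD3 n - 4 * JD3 n =
         (if n mod 3 = 0 then 2 - 3 * \<epsilon> else if n mod 3 = 1 then - 3 + \<epsilon> else 1 + 2 * \<epsilon>)"
proof (intro conjI)
  have "third_order_rec (\<lambda>n. jD3 (n + 3) - 3 * JD3 (n + 3) - 2 * jD3 n)"
    by (intro third_order_rec_intros)
  from third_order_rec_zero[OF this, of n]
  show "jD3 (n + 3) - 3 * JD3 (n + 3) = 2 * jD3 n"
    by (simp add: JD3_values jD3_values)
next
  have "third_order_rec (\<lambda>n. jD3 n + jD3 (n + 1) - 3 * JD3 (n + 2))"
    by (intro third_order_rec_intros)
  from third_order_rec_zero[OF this, of n]
  show "jD3 n + jD3 (n + 1) = 3 * JD3 (n + 2)"
    by (simp add: JD3_values jD3_values flip: numeral_2_eq_2)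
next
  have "third_order_rec (\<lambda>n. jD3 n - JD3 (n + 2))"
    by (intro third_order_rec_intros)
  from third_order_rec_periodic[OF this, of n]
  show "jD3 n - JD3 (n + 2) =
      (if n mod 3 = 0 then 1 - \<epsilon> else if n mod 3 = 1 then - 1 else \<epsilon>)"
    by (simp add: JD3_values jD3_values flip: numeral_2_eq_2)
next
  have "third_order_rec (\<lambda>n. jD3 n - 4 * JD3 n)"
    by (intro third_order_rec_intros)
  from third_order_rec_periodic[OF this, of n]
  show "jD3 n - 4 * JD3 n =
      (if n mod 3 = 0 then 2 - 3 * \<epsilon> else if n mod 3 = 1 then - 3 + \<epsilon> else 1 + 2 * \<epsilon>)"
    by (simp add: JD3_values jD3_values)
qed

end
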